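(* Let $G$ be a simple graph with vertex set $[\ell]=\{1,\dots,\ell\}$, and for $i=0,1,\dots,\ell-1$ let $$f_i(G)=\sum_{W\subset[\ell],\ \#W=\ell-i}c(G[W]),$$ where $c(G[W])$ is the number of connected components of the induced subgraph $G[W]$ of $G$ on $W$. Then $$\mathrm{Hilb}\big(D(\mathcal{A}_G),t\big)=\sum_{i=0}^{\ell-1}f_i(G)\frac{t^i}{(1-t)^{i+1}}.$$
   Context: Let $\mathbb{K}$ be a field and $S=\mathbb{K}[x_1,\dots,x_\ell]$ with $\deg x_i=1$, the coordinate ring of $\mathbb{K}^\ell$. For a simple graph $G$ with vertex set $[\ell]$ and edge set $E(G)$, the graphic arrangement is $\mathcal{A}_G=\{\{x_u=x_v\}\mid\{u,v\}\in E(G)\}$. Let $\mathrm{Der}(S)=\bigoplus_{i=1}^\ell S\,\partial_{x_i}$. For an arrangement $\mathcal{A}$ of linear hyperplanes $H$ with defining linear forms $\alpha_H$, the logarithmic vector field module is $$D(\mathcal{A})=\{\theta\in\mathrm{Der}(S)\mid\theta(\alpha_H)\in(\alpha_H)\text{ for all }H\in\mathcal{A}\},$$ graded by $\deg(\partial_{x_i})=0$. For a graded module $M=\bigoplus_{i\in\mathbb{Z}}M_i$, $\mathrm{Hilb}(M,t)=\sum_{i\in\mathbb{Z}}(\dim_{\mathbb{K}}M_i)t^i$. *)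

theory Defs
  imports
    "HOL-Library.Poly_Mapping"
    "HOL-Computational_Algebra.Formal_Power_Series"
begin

text \<open>
  A polynomial maps exponent vectors to coefficients, both with finite support; the
  multiplication of type \<open>\<Rightarrow>\<^sub>0\<close> is convolution, i.e. the product of polynomials.
  The ring \<open>S = K[x_1,...,x_l]\<close> is carved out of the polynomials in the variables \<open>x_0, x_1, ...\<close>.
\<close>

type_synonym 'k mpoly = "(nat \<Rightarrow>\<^sub>0 nat) \<Rightarrow>\<^sub>0 'k"

definition poly_ring :: "nat \<Rightarrow> 'k::field mpoly set" where
  "poly_ring l = {p. \<forall>m\<in>Poly_Mapping.keys p. Poly_Mapping.keys m \<subseteq> {1..l}}"

definition Const :: "'k::field \<Rightarrow> 'k mpoly" where
  "Const c = Poly_Mapping.single 0 c"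

definition Var :: "nat \<Rightarrow> 'k::field mpoly" where
  "Var i = Poly_Mapping.single (Poly_Mapping.single i 1) 1"

definition total_degree :: "(nat \<Rightarrow>\<^sub>0 nat) \<Rightarrow> nat" where
  "total_degree m = (\<Sum>i\<in>Poly_Mapping.keys m. Poly_Mapping.lookup m i)"

definition homogeneous :: "nat \<Rightarrow> 'k::field mpoly \<Rightarrow> bool" where
  "homogeneous d p \<longleftrightarrow> (\<forall>m\<in>Poly_Mapping.keys p. total_degree m = d)"

definition partial_deriv :: "nat \<Rightarrow> 'k::field mpoly \<Rightarrow> 'k mpoly" where
  "partial_deriv i p =
     (\<Sum>m\<in>Poly_Mapping.keys p.
        Poly_Mapping.single (m - Poly_Mapping.single i 1)
          (of_nat (Poly_Mapping.lookup m i) * Poly_Mapping.lookup p m))"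

definition principal_ideal :: "nat \<Rightarrow> 'k::field mpoly \<Rightarrow> 'k mpoly set" where
  "principal_ideal l a = {s * a |s. s \<in> poly_ring l}"

text \<open>
  The derivation \<open>\<theta> = \<theta>_1 \<partial>_1 + ... + \<theta>_l \<partial>_l\<close> is represented by its coefficients
  \<open>\<theta>_i = lookup \<theta> i\<close>.  Of the ring structure that type \<open>\<Rightarrow>\<^sub>0\<close> carries, only the
  (pointwise) addition is meaningful for derivations.
\<close>

type_synonym 'k der = "nat \<Rightarrow>\<^sub>0 'k mpoly"

definition Der :: "nat \<Rightarrow> 'k::field der set" where
  "Der l = {\<theta>. Poly_Mapping.keys \<theta> \<subseteq> {1..l} \<and>
               (\<forall>i. Poly_Mapping.lookup \<theta> i \<in> poly_ring l)}"

definition der_apply :: "'k::field der \<Rightarrow> 'k mpoly \<Rightarrow> 'k mpoly" where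
  "der_apply \<theta> p =
     (\<Sum>i\<in>Poly_Mapping.keys \<theta>. Poly_Mapping.lookup \<theta> i * partial_deriv i p)"

definition der_scale :: "'k::field \<Rightarrow> 'k der \<Rightarrow> 'k der" where
  "der_scale c \<theta> = Poly_Mapping.map (\<lambda>p. Const c * p) \<theta>"

lemma lookup_der_scale:
  "Poly_Mapping.lookup (der_scale c \<theta>) i = Const c * Poly_Mapping.lookup \<theta> i"
  by (simp add: der_scale_def map.rep_eq when_def)

lemma vector_space_der_scale: "vector_space (der_scale :: 'k::field \<Rightarrow> 'k der \<Rightarrow> 'k der)"
proof
  fix a b :: 'k and x y :: "'k der"
  show "der_scale a (x + y) = der_scale a x + der_scale a y"
    by (rule poly_mapping_eqI) (simp add: lookup_der_scale lookup_add distrib_left)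
  show "der_scale (a + b) x = der_scale a x + der_scale b x"
    by (rule poly_mapping_eqI)
      (simp add: lookup_der_scale lookup_add distrib_right Const_def single_add)
  show "der_scale a (der_scale b x) = der_scale (a * b) x"
    by (rule poly_mapping_eqI)
      (simp add: lookup_der_scale Const_def mult_single flip: mult.assoc)
  show "der_scale 1 x = x"
    by (rule poly_mapping_eqI) (simp add: lookup_der_scale Const_def)
qed

definition affine_space :: "nat \<Rightarrow> (nat \<Rightarrow> 'k::field) set" where
  "affine_space l = (\<Pi>\<^sub>E i\<in>{1..l}. UNIV)"

definition defining_form :: "nat \<Rightarrow> (nat \<Rightarrow> 'k::field) set \<Rightarrow> 'k mpoly \<Rightarrow> bool" where
  "defining_form l H \<alpha> \<longleftrightarrow>
     (\<exists>a. \<alpha> = (\<Sum>i\<in>{1..l}. Const (a i) * Var i) \<and> \<alpha> \<noteq> 0 \<and>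
          H = {p \<in> affine_space l. (\<Sum>i\<in>{1..l}. a i * p i) = 0})"

text \<open>
  A defining form of a linear hyperplane is unique up to a nonzero scalar, so that
  \<open>\<theta>(\<alpha>) \<in> (\<alpha>)\<close> does not depend on its choice.
\<close>

definition log_der :: "nat \<Rightarrow> (nat \<Rightarrow> 'k::field) set set \<Rightarrow> 'k der set" where
  "log_der l \<A> =
     {\<theta> \<in> Der l. \<forall>H\<in>\<A>. \<forall>\<alpha>. defining_form l H \<alpha> \<longrightarrow> der_apply \<theta> \<alpha> \<in> principal_ideal l \<alpha>}"

text \<open>
  Since \<open>\<partial>_i\<close> has degree 0, a derivation is homogeneous of degree \<open>d\<close> iff all its
  coefficients are, and there is nothing in negative degrees; hence the Hilbert series is a
  power series.  The graded pieces of submodules of \<open>Der l\<close> are finite-dimensional, so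
  \<open>dim\<close> does not take its default value 0 there.
\<close>

definition graded_part :: "'k::field der set \<Rightarrow> nat \<Rightarrow> 'k der set" where
  "graded_part M d = {\<theta> \<in> M. \<forall>i. homogeneous d (Poly_Mapping.lookup \<theta> i)}"

definition Hilb :: "'k::field der set \<Rightarrow> rat fps" where
  "Hilb M = Abs_fps (\<lambda>d. of_nat (vector_space.dim der_scale (graded_part M d)))"

definition simple_graph :: "nat set \<Rightarrow> nat set set \<Rightarrow> bool" where
  "simple_graph V E \<longleftrightarrow> finite V \<and> (\<forall>e\<in>E. e \<subseteq> V \<and> card e = 2)"

definition induced_edges :: "nat set set \<Rightarrow> nat set \<Rightarrow> nat set set" where
  "induced_edges E W = {e \<in> E. e \<subseteq> W}"

definition connected_rel :: "nat set \<Rightarrow> nat set set \<Rightarrow> (nat \<times> nat) set" where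
  "connected_rel V E = {(u, v). u \<in> V \<and> v \<in> V \<and> (u, v) \<in> {(a, b). {a, b} \<in> E}\<^sup>*}"

definition num_components :: "nat set \<Rightarrow> nat set set \<Rightarrow> nat" where
  "num_components V E = card (V // connected_rel V E)"

definition f_num :: "nat \<Rightarrow> nat set set \<Rightarrow> nat \<Rightarrow> nat" where
  "f_num l E i =
     (\<Sum>W | W \<subseteq> {1..l} \<and> card W = l - i. num_components W (induced_edges E W))"

definition graphic_arrangement :: "nat \<Rightarrow> nat set set \<Rightarrow> (nat \<Rightarrow> 'k::field) set set" where
  "graphic_arrangement l E = {{p \<in> affine_space l. p u = p v} |u v. {u, v} \<in> E}"

end

theory Submission
  imports Defs
begin

text \<open>
  For a graphic arrangement, \<open>\<theta>\<close> is logarithmic iff \<open>x_u - x_v\<close> divides \<open>\<theta>_u - \<theta>_v\<close> for every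
  edge \<open>uv\<close>.  Rewrite each \<open>\<theta>_u\<close> in the coordinates \<open>y = x_u\<close> and \<open>z_v = y - x_v\<close>, \<open>v \<noteq> u\<close>.
  The condition at \<open>uv\<close> then says that \<open>\<theta>_u\<close> at \<open>z_v = 0\<close> equals \<open>\<theta>_v\<close> at \<open>z_u = 0\<close>, that is,
  \<open>\<theta>_u\<close> and \<open>\<theta>_v\<close> have the same coefficient at every monomial free of \<open>z_u\<close> and \<open>z_v\<close>.
  So a logarithmic derivation assigns to each monomial \<open>m\<close> in \<open>y\<close> and the \<open>z_v\<close> a function that is
  constant on the connected components of \<open>G[W]\<close>, where \<open>W\<close> is the set of all \<open>w\<close> such that
  \<open>z_w\<close> does not occur in \<open>m\<close>.  The monomials with a given \<open>W\<close>, \<open>#W = l - i\<close>, have the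
  generating function \<open>t^i / (1 - t)^(i + 1)\<close>.
\<close>

abbreviation lookup :: "('a \<Rightarrow>\<^sub>0 'b::zero) \<Rightarrow> 'a \<Rightarrow> 'b" where
  "lookup \<equiv> Poly_Mapping.lookup"

abbreviation keys :: "('a \<Rightarrow>\<^sub>0 'b::zero) \<Rightarrow> 'a set" where
  "keys \<equiv> Poly_Mapping.keys"

abbreviation single :: "'a \<Rightarrow> 'b \<Rightarrow> 'a \<Rightarrow>\<^sub>0 'b::zero" where
  "single \<equiv> Poly_Mapping.single"

section \<open>Substitution into polynomials\<close>

lemma sum_singles: "(\<Sum>m\<in>keys p. single m (lookup p m)) = p"
  for p :: "'a \<Rightarrow>\<^sub>0 'b::comm_monoid_add"
  by (rule poly_mapping_eqI)
    (auto simp: lookup_sum lookup_single when_def in_keys_iff sum.delta)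

text \<open>Reduces additive statements about polynomials to single terms; identities such as
  multiplicativity of a substitution then follow from the monomial case.\<close>

lemma poly_mapping_single_induct [case_names single add]:
  fixes p :: "'a \<Rightarrow>\<^sub>0 'b::comm_monoid_add"
  assumes "\<And>m c. P (single m c)" "\<And>p q. P p \<Longrightarrow> P q \<Longrightarrow> P (p + q)"
  shows "P p"
proof -
  have "P (\<Sum>m\<in>A. single m (lookup p m))" if "finite A" for A
    using that
  proof induction
    case empty
    \<comment> \<open>Zero arises as a term with coefficient 0.\<close>
    show ?case using assms(1)[of undefined 0] by simp
  qed (simp add: assms)
  from this[of "keys p"] show ?thesis by (simp add: sum_singles)
qed

lemma Const_0 [simp]: "Const 0 = 0"
  by (simp add: Const_def)

lemma Const_1 [simp]: "Const 1 = 1"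
  by (simp add: Const_def)

lemma Const_add: "Const (a + b) = Const a + Const b"
  by (simp add: Const_def single_add)

lemma Const_mult: "Const (a * b) = Const a * Const b"
  by (simp add: Const_def mult_single)

lemma Const_uminus: "Const (- a) = - Const a"
  by (simp add: Const_def single_uminus)

lemma Const_times_single: "Const c * single m a = single m (c * a)"
  by (simp add: Const_def mult_single)

lemma lookup_Const_times [simp]: "lookup (Const c * p) m = c * lookup p m"
proof (induction p rule: poly_mapping_single_induct)
  case (single m' a)
  then show ?case by (simp add: Const_times_single lookup_single when_def)
next
  case (add p q)
  then show ?case by (simp add: algebra_simps lookup_add)
qed

lemma keys_plus_nat: "keys (m + n) = keys m \<union> keys n" for m n :: "'a \<Rightarrow>\<^sub>0 nat"
  by (auto simp: in_keys_iff lookup_add)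

definition eval_monom :: "(nat \<Rightarrow> 'k::field mpoly) \<Rightarrow> (nat \<Rightarrow>\<^sub>0 nat) \<Rightarrow> 'k mpoly" where
  "eval_monom f m = (\<Prod>i\<in>keys m. f i ^ lookup m i)"

text \<open>The K-algebra endomorphism sending \<open>Var i\<close> to \<open>f i\<close>. Linear
  coordinate changes and restrictions to coordinate hyperplanes are both instances of it.\<close>

definition subst :: "(nat \<Rightarrow> 'k::field mpoly) \<Rightarrow> 'k mpoly \<Rightarrow> 'k mpoly" where
  "subst f p = (\<Sum>m\<in>keys p. Const (lookup p m) * eval_monom f m)"

lemma eval_monom_superset:
  assumes "finite A" "keys m \<subseteq> A"
  shows "eval_monom f m = (\<Prod>i\<in>A. f i ^ lookup m i)"
  unfolding eval_monom_def using assms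
  by (intro prod.mono_neutral_left) (auto simp: in_keys_iff)

lemma eval_monom_add: "eval_monom f (m + n) = eval_monom f m * eval_monom f n"
proof -
  let ?A = "keys m \<union> keys n"
  have "eval_monom f (m + n) = (\<Prod>i\<in>?A. f i ^ lookup (m + n) i)"
    by (rule eval_monom_superset) (auto simp: keys_plus_nat)
  also have "\<dots> = (\<Prod>i\<in>?A. f i ^ lookup m i) * (\<Prod>i\<in>?A. f i ^ lookup n i)"
    by (simp add: lookup_add power_add prod.distrib)
  also have "\<dots> = eval_monom f m * eval_monom f n"
    by (simp add: eval_monom_superset[of ?A])
  finally show ?thesis .
qed

lemma subst_superset:
  assumes "finite A" "keys p \<subseteq> A"
  shows "subst f p = (\<Sum>m\<in>A. Const (lookup p m) * eval_monom f m)"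
  unfolding subst_def using assms
  by (intro sum.mono_neutral_left) (auto simp: in_keys_iff)

lemma subst_0 [simp]: "subst f 0 = 0"
  by (simp add: subst_def)

lemma subst_add: "subst f (p + q) = subst f p + subst f q"
proof -
  let ?A = "keys p \<union> keys q"
  have "subst f (p + q) = (\<Sum>m\<in>?A. Const (lookup (p + q) m) * eval_monom f m)"
    by (rule subst_superset) (use keys_add[of p q] in auto)
  also have "\<dots> = (\<Sum>m\<in>?A. Const (lookup p m) * eval_monom f m)
      + (\<Sum>m\<in>?A. Const (lookup q m) * eval_monom f m)"
    by (simp add: lookup_add Const_add distrib_right sum.distrib)
  also have "\<dots> = subst f p + subst f q"
    by (simp add: subst_superset[of ?A])
  finally show ?thesis .
qed

lemma subst_single: "subst f (single m c) = Const c * eval_monom f m"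
  by (cases "c = 0") (auto simp: subst_def)

lemma subst_mult: "subst f (p * q) = subst f p * subst f q"
proof (induction p rule: poly_mapping_single_induct)
  case (single m a)
  show ?case
  proof (induction q rule: poly_mapping_single_induct)
    case (single n b)
    show ?case
      by (simp add: mult_single subst_single eval_monom_add Const_mult mult_ac)
  next
    case (add p q)
    then show ?case by (simp add: subst_add algebra_simps)
  qed
next
  case (add p q)
  then show ?case by (simp add: subst_add algebra_simps)
qed

lemma subst_Const [simp]: "subst f (Const c) = Const c"
  unfolding Const_def[of c] subst_single by (simp add: eval_monom_def Const_def)

lemma subst_1 [simp]: "subst f 1 = 1"
  using subst_Const[of f 1] by simp

lemma subst_Var [simp]: "subst f (Var i) = f i"
  by (simp add: Var_def subst_single eval_monom_def)

lemma subst_uminus: "subst f (- p) = - subst f p"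
  by (metis add.right_inverse add_eq_0_iff subst_0 subst_add)

lemma subst_diff: "subst f (p - q) = subst f p - subst f q"
  using subst_add[of f p "- q"] by (simp add: subst_uminus)

lemma subst_power: "subst f (p ^ n) = subst f p ^ n"
  by (induction n) (simp_all add: subst_mult)

lemma subst_prod: "subst f (prod g A) = (\<Prod>i\<in>A. subst f (g i))"
  by (induction A rule: infinite_finite_induct) (simp_all add: subst_mult)

text \<open>A composite of algebra homomorphisms is determined by its values on the variables, so
  identities between composed substitutions need checking only there.\<close>

lemma subst_subst: "subst g (subst f p) = subst (\<lambda>i. subst g (f i)) p"
proof (induction p rule: poly_mapping_single_induct)
  case (single m c)
  then show ?case
    by (simp add: subst_single subst_mult eval_monom_def subst_prod subst_power)
next
  case (add p q)
  then show ?case by (simp add: subst_add)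
qed

lemma Var_power: "Var i ^ n = single (single i n) 1"
  by (induction n) (simp_all add: Var_def mult_single flip: single_add)

lemma prod_single_one:
  "(\<Prod>i\<in>A. single (g i) 1) = single (\<Sum>i\<in>A. g i) (1 :: 'k::field)"
  by (induction A rule: infinite_finite_induct) (simp_all add: mult_single)

lemma eval_monom_Var: "eval_monom Var m = single m 1"
  by (simp add: eval_monom_def Var_power prod_single_one sum_singles)

lemma subst_Var_id [simp]: "subst Var p = p"
  by (simp add: subst_def eval_monom_Var Const_times_single sum_singles)

section \<open>Polynomials in a given set of variables\<close>

text \<open>Coordinates centred at a vertex \<open>u\<close> use \<open>x_0\<close> and omit
  \<open>x_u\<close>, so variable sets other than \<open>{1..l}\<close> occur.\<close>

definition polys_in :: "nat set \<Rightarrow> 'k::field mpoly set" where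
  "polys_in V = {p. \<forall>m\<in>keys p. keys m \<subseteq> V}"

lemma poly_ring_eq: "poly_ring l = polys_in {1..l}"
  by (simp add: poly_ring_def polys_in_def)

lemma polys_in_0 [simp]: "0 \<in> polys_in V"
  by (simp add: polys_in_def)

lemma polys_in_single: "keys m \<subseteq> V \<Longrightarrow> single m c \<in> polys_in V"
  by (simp add: polys_in_def)

lemma polys_in_Const [simp]: "Const c \<in> polys_in V"
  by (simp add: Const_def polys_in_single)

lemma polys_in_1 [simp]: "1 \<in> polys_in V"
  using polys_in_Const[of 1 V] by simp

lemma polys_in_Var: "i \<in> V \<Longrightarrow> Var i \<in> polys_in V"
  by (simp add: Var_def polys_in_single)

lemma polys_in_add: "p \<in> polys_in V \<Longrightarrow> q \<in> polys_in V \<Longrightarrow> p + q \<in> polys_in V"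
  using keys_add[of p q] by (auto simp: polys_in_def)

lemma polys_in_mult:
  assumes "p \<in> polys_in V" "q \<in> polys_in V"
  shows "p * q \<in> polys_in V"
  unfolding polys_in_def
proof (intro CollectI ballI)
  fix m assume "m \<in> keys (p * q)"
  then obtain a b where "m = a + b" "a \<in> keys p" "b \<in> keys q"
    using keys_mult[of p q] by auto
  then show "keys m \<subseteq> V"
    using assms by (auto simp: polys_in_def keys_plus_nat)
qed

lemma polys_in_uminus: "p \<in> polys_in V \<Longrightarrow> - p \<in> polys_in V"
  by (simp add: polys_in_def in_keys_iff)

lemma polys_in_diff: "p \<in> polys_in V \<Longrightarrow> q \<in> polys_in V \<Longrightarrow> p - q \<in> polys_in V"
  using polys_in_add[of p V "- q"] by (simp add: polys_in_uminus)

lemma polys_in_power: "p \<in> polys_in V \<Longrightarrow> p ^ n \<in> polys_in V"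
  by (induction n) (simp_all add: polys_in_mult)

lemma polys_in_prod: "(\<And>i. i \<in> A \<Longrightarrow> g i \<in> polys_in V) \<Longrightarrow> prod g A \<in> polys_in V"
  by (induction A rule: infinite_finite_induct) (simp_all add: polys_in_mult)

lemma polys_in_sum: "(\<And>i. i \<in> A \<Longrightarrow> g i \<in> polys_in V) \<Longrightarrow> sum g A \<in> polys_in V"
  by (induction A rule: infinite_finite_induct) (simp_all add: polys_in_add)

lemma polys_in_subst:
  assumes p: "p \<in> polys_in V" and f: "\<And>i. i \<in> V \<Longrightarrow> f i \<in> polys_in U"
  shows "subst f p \<in> polys_in U"
  unfolding subst_def eval_monom_def
proof (intro polys_in_sum polys_in_mult polys_in_prod polys_in_power polys_in_Const f)
  show "i \<in> V" if "m \<in> keys p" "i \<in> keys m" for m i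
    using p that by (auto simp: polys_in_def)
qed

lemma subst_cong:
  assumes "p \<in> polys_in V" "\<And>i. i \<in> V \<Longrightarrow> f i = g i"
  shows "subst f p = subst g p"
  unfolding subst_def eval_monom_def using assms
  by (intro sum.cong prod.cong arg_cong2[where f = "(*)"] arg_cong2[where f = "(^)"] refl)
    (auto simp: polys_in_def)

text \<open>Lowering the exponent of \<open>i\<close> in every monomial gives the quotient, which
  stays within the variables \<open>V\<close>.\<close>

lemma Var_dvd:
  assumes "q \<in> polys_in V" "\<And>m. m \<in> keys q \<Longrightarrow> i \<in> keys m"
  obtains r where "r \<in> polys_in V" "q = Var i * r"
proof
  let ?r = "\<Sum>m\<in>keys q. single (m - single i 1) (lookup q m)"
  show "?r \<in> polys_in V"
  proof (intro polys_in_sum polys_in_single)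
    fix m assume "m \<in> keys q"
    moreover have "keys (m - single i 1) \<subseteq> keys m"
      by (auto simp: in_keys_iff lookup_minus)
    ultimately show "keys (m - single i 1) \<subseteq> V"
      using assms(1) by (auto simp: polys_in_def)
  qed
  have "Var i * ?r = (\<Sum>m\<in>keys q. single m (lookup q m))"
    unfolding sum_distrib_left
  proof (rule sum.cong[OF refl])
    fix m assume "m \<in> keys q"
    then have "lookup m i \<noteq> 0" using assms(2) by (simp add: in_keys_iff)
    \<comment> \<open>Subtraction of exponents is truncated; a positive exponent of \<open>i\<close>
      makes it reversible.\<close>
    then have "single i 1 + (m - single i 1) = m"
      by (intro poly_mapping_eqI) (auto simp: lookup_add lookup_minus lookup_single when_def)
    then show "Var i * single (m - single i 1) (lookup q m) = single m (lookup q m)"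
      by (simp add: Var_def mult_single)
  qed
  then show "q = Var i * ?r" by (simp add: sum_singles)
qed

section \<open>Homogeneous polynomials\<close>

lemma total_degree_superset:
  assumes "finite A" "keys m \<subseteq> A"
  shows "total_degree m = (\<Sum>i\<in>A. lookup m i)"
  unfolding total_degree_def using assms
  by (intro sum.mono_neutral_left) (auto simp: in_keys_iff)

lemma total_degree_add: "total_degree (m + n) = total_degree m + total_degree n"
proof -
  let ?A = "keys m \<union> keys n"
  have "total_degree (m + n) = (\<Sum>i\<in>?A. lookup (m + n) i)"
    by (rule total_degree_superset) (auto simp: keys_plus_nat)
  then show ?thesis
    by (simp add: lookup_add sum.distrib total_degree_superset[of ?A])
qed

lemma total_degree_0 [simp]: "total_degree 0 = 0"
  by (simp add: total_degree_def)

lemma total_degree_single [simp]: "total_degree (single i n) = n"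
  by (simp add: total_degree_def)

lemma homogeneous_0 [simp]: "homogeneous d 0"
  by (simp add: homogeneous_def)

lemma homogeneous_single: "total_degree m = d \<Longrightarrow> homogeneous d (single m c)"
  by (simp add: homogeneous_def)

lemma homogeneous_Const [simp]: "homogeneous 0 (Const c)"
  by (simp add: Const_def homogeneous_single)

lemma homogeneous_1 [simp]: "homogeneous 0 1"
  using homogeneous_Const[of 1] by simp

lemma homogeneous_Var [simp]: "homogeneous 1 (Var i)"
  by (simp add: Var_def homogeneous_single)

lemma homogeneous_add: "homogeneous d p \<Longrightarrow> homogeneous d q \<Longrightarrow> homogeneous d (p + q)"
  using keys_add[of p q] by (auto simp: homogeneous_def)

lemma homogeneous_uminus: "homogeneous d p \<Longrightarrow> homogeneous d (- p)"
  by (simp add: homogeneous_def in_keys_iff)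

lemma homogeneous_diff: "homogeneous d p \<Longrightarrow> homogeneous d q \<Longrightarrow> homogeneous d (p - q)"
  using homogeneous_add[of d p "- q"] by (simp add: homogeneous_uminus)

lemma homogeneous_mult:
  assumes "homogeneous a p" "homogeneous b q"
  shows "homogeneous (a + b) (p * q)"
  unfolding homogeneous_def
proof
  fix m assume "m \<in> keys (p * q)"
  then obtain m1 m2 where "m = m1 + m2" "m1 \<in> keys p" "m2 \<in> keys q"
    using keys_mult[of p q] by auto
  then show "total_degree m = a + b"
    using assms by (simp add: homogeneous_def total_degree_add)
qed

lemma homogeneous_power: "homogeneous 1 p \<Longrightarrow> homogeneous n (p ^ n)"
proof (induction n)
  case (Suc n)
  then show ?case using homogeneous_mult[of 1 p n "p ^ n"] by simp
qed simp

lemma homogeneous_prod: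
  "(\<And>i. i \<in> A \<Longrightarrow> homogeneous (d i) (g i)) \<Longrightarrow> homogeneous (\<Sum>i\<in>A. d i) (prod g A)"
  by (induction A rule: infinite_finite_induct) (simp_all add: homogeneous_mult)

lemma homogeneous_sum: "(\<And>i. i \<in> A \<Longrightarrow> homogeneous d (g i)) \<Longrightarrow> homogeneous d (sum g A)"
  by (induction A rule: infinite_finite_induct) (simp_all add: homogeneous_add)

lemma homogeneous_Const_mult: "homogeneous d p \<Longrightarrow> homogeneous d (Const c * p)"
  using homogeneous_mult[of 0 "Const c" d p] by simp

lemma homogeneous_subst:
  assumes "homogeneous d p" "\<And>i. homogeneous 1 (f i)"
  shows "homogeneous d (subst f p)"
  unfolding subst_def
proof (intro homogeneous_sum homogeneous_Const_mult)
  fix m assume "m \<in> keys p"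
  then have d: "d = (\<Sum>i\<in>keys m. lookup m i)"
    using assms(1) by (simp add: homogeneous_def total_degree_def)
  show "homogeneous d (eval_monom f m)"
    unfolding eval_monom_def d by (intro homogeneous_prod homogeneous_power assms(2))
qed

section \<open>Straightening the hyperplanes\<close>

text \<open>
  The substitution \<open>shear u 0\<close> passes to the coordinates \<open>y = x_u\<close> and \<open>z_v = x_u - x_v\<close>,
  where \<open>y\<close> is named \<open>x_0\<close> and \<open>z_v\<close> is named \<open>x_v\<close>.
\<close>

definition shear :: "nat \<Rightarrow> nat \<Rightarrow> nat \<Rightarrow> 'k::field mpoly" where
  "shear a b v = (if v = a then Var b else Var b - Var v)"

text \<open>Restriction to the coordinate hyperplane \<open>x_a = 0\<close>.\<close>

definition kill :: "nat \<Rightarrow> nat \<Rightarrow> 'k::field mpoly" where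
  "kill a v = (if v = a then 0 else Var v)"

text \<open>For \<open>v\<close> other than \<open>a\<close> and \<open>b\<close>, the variable
  \<open>x_v\<close> goes to \<open>x_b - x_v\<close> and then to
  \<open>x_a - (x_a - x_v) = x_v\<close>. If a \<noteq> b, the first map sends \<open>x_b\<close> to
  0, so it can be undone only on polynomials free of \<open>x_b\<close>.\<close>

lemma shear_shear:
  assumes "p \<in> polys_in (- {b})"
  shows "subst (shear b a) (subst (shear a b) p) = p"
proof -
  have "subst (shear b a) (subst (shear a b) p) = subst Var p"
    unfolding subst_subst using assms
    by (rule subst_cong) (auto simp: shear_def subst_diff)
  then show ?thesis by simp
qed

lemma homogeneous_shear: "homogeneous 1 (shear a b v)"
  by (auto simp: shear_def simp del: One_nat_def intro!: homogeneous_diff)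

lemma polys_in_shear:
  assumes "p \<in> polys_in V" "a \<noteq> b"
  shows "subst (shear a b) p \<in> polys_in (insert b V - {a})"
  using assms(1)
  by (rule polys_in_subst) (use assms(2) in \<open>auto simp: shear_def intro!: polys_in_diff polys_in_Var\<close>)

text \<open>Turns an equality of restrictions into an equality of the coefficients at all monomials
  that avoid \<open>x_a\<close>.\<close>

lemma lookup_kill:
  fixes p :: "'k::field mpoly"
  shows "lookup (subst (kill a) p) m = (if a \<in> keys m then 0 else lookup p m)"
proof (induction p rule: poly_mapping_single_induct)
  case (single n c)
  have "eval_monom (kill a) n = (if a \<in> keys n then 0 else single n (1 :: 'k))"
  proof (cases "a \<in> keys n")
    case True
    then have "eval_monom (kill a) n = (0 :: 'k mpoly)"
      unfolding eval_monom_def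
      by (intro prod_zero) (auto simp: kill_def in_keys_iff intro!: bexI[of _ a])
    with True show ?thesis by simp
  next
    case False
    then have "eval_monom (kill a) n = (eval_monom Var n :: 'k mpoly)"
      unfolding eval_monom_def by (intro prod.cong) (auto simp: kill_def)
    with False show ?thesis by (simp add: eval_monom_Var)
  qed
  then show ?case
    by (simp add: subst_single lookup_single when_def)
next
  case (add p q)
  then show ?case by (simp add: subst_add lookup_add)
qed

text \<open>On the hyperplane \<open>x_a = x_b\<close> the coordinates centred at \<open>a\<close>
  and at \<open>b\<close> coincide: it is \<open>z_b = 0\<close> in the former and
  \<open>z_a = 0\<close> in the latter.\<close>

lemma kill_shear_commute:
  fixes p :: "'k::field mpoly"
  assumes "a \<noteq> 0" "b \<noteq> 0"
  shows "subst (kill b) (subst (shear a 0) p) = subst (kill a) (subst (shear b 0) p)"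
proof -
  have "subst (kill b) (shear a 0 v) = (subst (kill a) (shear b 0 v) :: 'k mpoly)" for v
    using assms by (simp add: shear_def kill_def subst_diff)
  then show ?thesis by (simp add: subst_subst)
qed

text \<open>In the coordinates centred at \<open>a\<close> the form \<open>x_a - x_b\<close> becomes
  a variable, so divisibility can be read off from the monomials. On those free of both variables,
  \<open>kill_shear_commute\<close> exchanges the coordinates at \<open>a\<close> for those at
  \<open>b\<close>.\<close>

lemma diff_in_principal_ideal_iff:
  fixes p q :: "'k::field mpoly"
  assumes a: "a \<in> {1..l}" and b: "b \<in> {1..l}" and ab: "a \<noteq> b"
    and p: "p \<in> poly_ring l" and q: "q \<in> poly_ring l"
  shows "p - q \<in> principal_ideal l (Var a - Var b) \<longleftrightarrow>
    (\<forall>m. a \<notin> keys m \<and> b \<notin> keys m \<longrightarrow>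
      lookup (subst (shear a 0) p) m = lookup (subst (shear b 0) q) m)"
    (is "?L \<longleftrightarrow> ?R")
proof -
  have nz: "a \<noteq> 0" "b \<noteq> 0" using a b by auto
  have shear_ab: "subst (shear a 0) (Var a - Var b) = (Var b :: 'k mpoly)"
    "shear 0 a b = (Var a - Var b :: 'k mpoly)"
    using ab nz by (simp_all add: shear_def subst_diff)
  show ?thesis
  proof
    assume ?L
    then obtain s where "p = q + s * (Var a - Var b)"
      unfolding principal_ideal_def by (auto simp: algebra_simps)
    then have "subst (shear a 0) p = subst (shear a 0) q + subst (shear a 0) s * Var b"
      by (simp add: subst_add subst_mult shear_ab)
    then have "subst (kill b) (subst (shear a 0) p) = subst (kill b) (subst (shear a 0) q)"
      by (simp add: subst_add subst_mult) (simp add: kill_def)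
    also have "\<dots> = subst (kill a) (subst (shear b 0) q)"
      by (rule kill_shear_commute[OF nz])
    finally have "lookup (subst (kill b) (subst (shear a 0) p)) m =
        lookup (subst (kill a) (subst (shear b 0) q)) m" for m
      by simp
    then show ?R unfolding lookup_kill by (metis (no_types))
  next
    assume R: ?R
    let ?h = "subst (shear a 0) (p - q)"
    have pq: "p - q \<in> polys_in {1..l}"
      using p q by (simp add: poly_ring_eq polys_in_diff)
    have h_in: "?h \<in> polys_in (insert 0 {1..l} - {a})"
      using pq nz by (intro polys_in_shear) auto
    \<comment> \<open>The hypothesis speaks of \<open>q\<close> in the coordinates at
      \<open>b\<close>. A monomial free of both variables has the same coefficient in the
      coordinates at \<open>a\<close>, where the difference then vanishes.\<close>
    have "b \<in> keys m" if m: "m \<in> keys ?h" for m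
    proof (rule ccontr)
      assume bm: "b \<notin> keys m"
      have am: "a \<notin> keys m" using h_in m by (auto simp: polys_in_def)
      have "lookup (subst (shear a 0) q) m = lookup (subst (kill b) (subst (shear a 0) q)) m"
        using bm by (simp add: lookup_kill)
      also have "\<dots> = lookup (subst (shear b 0) q) m"
        unfolding kill_shear_commute[OF nz] using am by (simp add: lookup_kill)
      finally have "lookup ?h m = 0"
        using R am bm by (simp add: subst_diff lookup_minus)
      with m show False by (simp add: in_keys_iff)
    qed
    with h_in obtain r where r: "r \<in> polys_in (insert 0 {1..l} - {a})" "?h = Var b * r"
      by (rule Var_dvd)
    \<comment> \<open>Return to the original coordinates, where the factor \<open>Var b\<close>
      becomes \<open>x_a - x_b\<close> again.\<close>
    have "p - q = subst (shear 0 a) ?h"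
      by (rule shear_shear[symmetric]) (use pq in \<open>fastforce simp: polys_in_def\<close>)
    also have "\<dots> = subst (shear 0 a) r * (Var a - Var b)"
      by (simp add: r(2) subst_mult shear_ab)
    finally have "p - q = subst (shear 0 a) r * (Var a - Var b)" .
    \<comment> \<open>The inverse change of coordinates trades \<open>x_0\<close> for
      \<open>x_a\<close>, so the cofactor lies in \<open>S\<close>.\<close>
    moreover have "subst (shear 0 a) r \<in> polys_in (insert a (insert 0 {1..l} - {a}) - {0})"
      using r(1) nz by (intro polys_in_shear) auto
    moreover have "insert a (insert 0 {1..l} - {a}) - {0} = {1..l}"
      using a by auto
    ultimately show ?L
      unfolding principal_ideal_def poly_ring_eq by auto
  qed
qed

section \<open>Derivations of a graphic arrangement\<close>

lemma single_1_eq_iff: "single a (Suc 0) = single b (Suc 0) \<longleftrightarrow> a = b"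
  by (metis keys_single singleton_inject nat.distinct(1))

text \<open>The coefficients of a form vanishing on the hyperplane are found by evaluating it at 0/1
  vectors. This works over every field, finite ones included.\<close>

lemma defining_form_diagonal_iff:
  fixes \<alpha> :: "'k::field mpoly"
  assumes a: "a \<in> {1..l}" and b: "b \<in> {1..l}" and ab: "a \<noteq> b"
  shows "defining_form l {p \<in> affine_space l. p a = p b} \<alpha> \<longleftrightarrow>
    (\<exists>c. c \<noteq> 0 \<and> \<alpha> = Const c * (Var a - Var b))"
    (is "defining_form l ?H \<alpha> \<longleftrightarrow> ?R")
proof
  assume "defining_form l ?H \<alpha>"
  then obtain k where \<alpha>: "\<alpha> = (\<Sum>i\<in>{1..l}. Const (k i) * Var i)" "\<alpha> \<noteq> 0"
    and H: "?H = {p \<in> affine_space l. (\<Sum>i\<in>{1..l}. k i * p i) = 0}"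
    unfolding defining_form_def by blast
  \<comment> \<open>The indicator vector of \<open>A\<close> has equal entries at \<open>a\<close>
    and \<open>b\<close>, hence lies on the hyperplane. The pair \<open>{a, b}\<close> and the other
    singletons then give all the coefficients.\<close>
  have vanish: "(\<Sum>i\<in>A. k i) = 0" if A: "A \<subseteq> {1..l}" "a \<in> A \<longleftrightarrow> b \<in> A" for A
  proof -
    let ?p = "\<lambda>i\<in>{1..l}. if i \<in> A then 1 else (0 :: 'k)"
    have "?p \<in> ?H" using A a b by (auto simp: affine_space_def)
    then have "?p \<in> {p \<in> affine_space l. (\<Sum>i\<in>{1..l}. k i * p i) = 0}"
      unfolding H .
    then have "0 = (\<Sum>i\<in>{1..l}. k i * ?p i)"
      by simp
    also have "\<dots> = (\<Sum>i\<in>{1..l}. if i \<in> A then k i else 0)"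
      by (rule sum.cong) auto
    also have "\<dots> = (\<Sum>i\<in>A. k i)"
      using A(1) by (simp add: sum.If_cases Int_absorb1)
    finally show ?thesis by simp
  qed
  have kab: "k b = - k a"
    using vanish[of "{a, b}"] a b ab by (simp add: add_eq_0_iff)
  have k0: "k i = 0" if "i \<in> {1..l}" "i \<noteq> a" "i \<noteq> b" for i
    using vanish[of "{i}"] that by simp
  have "\<alpha> = (\<Sum>i\<in>{a, b}. Const (k i) * Var i)"
    unfolding \<alpha>(1) using a b k0 by (intro sum.mono_neutral_right) auto
  also have "\<dots> = Const (k a) * (Var a - Var b)"
    using ab by (simp add: kab Const_uminus algebra_simps)
  finally have "\<alpha> = Const (k a) * (Var a - Var b)" .
  with \<alpha>(2) show ?R by (intro exI[of _ "k a"]) auto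
next
  assume ?R
  then obtain c where c: "c \<noteq> 0" "\<alpha> = Const c * (Var a - Var b)" by blast
  let ?k = "\<lambda>i. if i = a then c else if i = b then - c else 0"
  have "(\<Sum>i\<in>{1..l}. Const (?k i) * Var i) = (\<Sum>i\<in>{a, b}. Const (?k i) * Var i)"
    using a b by (intro sum.mono_neutral_right) auto
  also have "\<dots> = \<alpha>"
    using ab c(2) by (simp add: Const_uminus algebra_simps)
  finally have 1: "\<alpha> = (\<Sum>i\<in>{1..l}. Const (?k i) * Var i)" by simp
  have "lookup \<alpha> (single a 1) = c"
    using ab c(2) by (simp add: lookup_minus Var_def lookup_single when_def single_1_eq_iff)
  with c(1) have 2: "\<alpha> \<noteq> 0" by auto
  have "(\<Sum>i\<in>{1..l}. ?k i * p i) = c * (p a - p b)" for p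
  proof -
    have "(\<Sum>i\<in>{1..l}. ?k i * p i) = (\<Sum>i\<in>{a, b}. ?k i * p i)"
      using a b by (intro sum.mono_neutral_right) auto
    then show ?thesis using ab by (simp add: algebra_simps)
  qed
  then have "?H = {p \<in> affine_space l. (\<Sum>i\<in>{1..l}. ?k i * p i) = 0}"
    using c(1) by simp
  with 1 2 show "defining_form l ?H \<alpha>"
    unfolding defining_form_def by (intro exI[of _ ?k]) simp
qed

lemma partial_deriv_Var_diff:
  assumes "a \<noteq> b"
  shows "partial_deriv i (Const c * (Var a - Var b)) =
    (if i = a then Const c else if i = b then - Const c else 0)"
proof (cases "c = 0")
  case True
  then show ?thesis by (simp add: partial_deriv_def)
next
  case False
  let ?p = "Const c * (Var a - Var b)" and ?a = "single a (1 :: nat)" and ?b = "single b (1 :: nat)"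
  have ne: "?a \<noteq> ?b"
    using assms by (simp add: single_1_eq_iff)
  have lk: "lookup ?p m = (if m = ?a then c else if m = ?b then - c else 0)" for m
    using ne by (auto simp: lookup_minus Var_def lookup_single when_def)
  then have "keys ?p = {?a, ?b}"
    using False by (auto simp: in_keys_iff simp del: lookup_Const_times One_nat_def split: if_splits)
  then have "partial_deriv i ?p =
      single (?a - single i 1) (of_nat (lookup ?a i) * c)
      + single (?b - single i 1) (of_nat (lookup ?b i) * - c)"
    unfolding partial_deriv_def using ne by (simp add: lk del: lookup_Const_times)
  \<comment> \<open>Where \<open>i\<close> does not occur, truncated subtraction leaves the exponent
    unchanged, but the factor \<open>of_nat 0\<close> removes the term.\<close>
  then show ?thesis
    using assms by (auto simp: lookup_single when_def Const_def single_uminus)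
qed

lemma der_apply_Var_diff:
  assumes "a \<noteq> b"
  shows "der_apply \<theta> (Const c * (Var a - Var b)) = Const c * (lookup \<theta> a - lookup \<theta> b)"
proof -
  let ?f = "\<lambda>i. lookup \<theta> i * partial_deriv i (Const c * (Var a - Var b))"
  have "der_apply \<theta> (Const c * (Var a - Var b)) = sum ?f (keys \<theta> \<union> {a, b})"
    unfolding der_apply_def by (intro sum.mono_neutral_left) (auto simp: in_keys_iff)
  also have "\<dots> = sum ?f {a, b}"
    by (intro sum.mono_neutral_right) (auto simp: partial_deriv_Var_diff[OF assms])
  also have "\<dots> = lookup \<theta> a * Const c + lookup \<theta> b * - Const c"
    using assms by (simp add: partial_deriv_Var_diff[OF assms])
  also have "\<dots> = Const c * (lookup \<theta> a - lookup \<theta> b)"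
    by (simp add: algebra_simps)
  finally show ?thesis .
qed

text \<open>All defining forms of the hyperplane of an edge \<open>{a, b}\<close> are nonzero
  multiples of \<open>x_a - x_b\<close>. The scalar cancels, which leaves the divisibility of
  \<open>lookup \<theta> a - lookup \<theta> b\<close> by \<open>x_a - x_b\<close>.\<close>

lemma log_der_graphic_iff:
  fixes \<theta> :: "'k::field der"
  assumes "simple_graph {1..l} E"
  shows "\<theta> \<in> log_der l (graphic_arrangement l E) \<longleftrightarrow> \<theta> \<in> Der l \<and>
    (\<forall>a b m. {a, b} \<in> E \<and> a \<notin> keys m \<and> b \<notin> keys m \<longrightarrow>
      lookup (subst (shear a 0) (lookup \<theta> a)) m = lookup (subst (shear b 0) (lookup \<theta> b)) m)"
proof (cases "\<theta> \<in> Der l")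
  case True
  have edge: "a \<in> {1..l}" "b \<in> {1..l}" "a \<noteq> b" if "{a, b} \<in> E" for a b
    using assms that unfolding simple_graph_def by fastforce+
  have edge_iff: "(\<forall>\<alpha>. defining_form l {p \<in> affine_space l. p a = p b} \<alpha> \<longrightarrow>
        der_apply \<theta> \<alpha> \<in> principal_ideal l \<alpha>) \<longleftrightarrow>
      (\<forall>m. a \<notin> keys m \<and> b \<notin> keys m \<longrightarrow>
        lookup (subst (shear a 0) (lookup \<theta> a)) m = lookup (subst (shear b 0) (lookup \<theta> b)) m)"
    (is "?A \<longleftrightarrow> ?B") if E: "{a, b} \<in> E" for a b
  proof -
    let ?\<alpha> = "Var a - Var b :: 'k mpoly"
    have "?A \<longleftrightarrow> (\<forall>c. c \<noteq> 0 \<longrightarrow>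
        Const c * (lookup \<theta> a - lookup \<theta> b) \<in> principal_ideal l (Const c * ?\<alpha>))"
      unfolding defining_form_diagonal_iff[OF edge[OF E]]
      by (metis (no_types) der_apply_Var_diff[OF edge(3)[OF E]])
    also have "\<dots> \<longleftrightarrow> lookup \<theta> a - lookup \<theta> b \<in> principal_ideal l ?\<alpha>"
    proof
      assume "\<forall>c. c \<noteq> 0 \<longrightarrow>
        Const c * (lookup \<theta> a - lookup \<theta> b) \<in> principal_ideal l (Const c * ?\<alpha>)"
      from this[rule_format, of 1]
      show "lookup \<theta> a - lookup \<theta> b \<in> principal_ideal l ?\<alpha>" by simp
    next
      assume "lookup \<theta> a - lookup \<theta> b \<in> principal_ideal l ?\<alpha>"
      then obtain s where s: "s \<in> poly_ring l" "lookup \<theta> a - lookup \<theta> b = s * ?\<alpha>"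
        unfolding principal_ideal_def by blast
      then have "Const c * (lookup \<theta> a - lookup \<theta> b) = s * (Const c * ?\<alpha>)" for c
        by (simp only: mult_ac)
      with s(1) show "\<forall>c. c \<noteq> 0 \<longrightarrow>
        Const c * (lookup \<theta> a - lookup \<theta> b) \<in> principal_ideal l (Const c * ?\<alpha>)"
        unfolding principal_ideal_def by blast
    qed
    also have "\<dots> \<longleftrightarrow> ?B"
      using True edge[OF E] by (intro diff_in_principal_ideal_iff) (auto simp: Der_def)
    finally show ?thesis .
  qed
  have "\<theta> \<in> log_der l (graphic_arrangement l E) \<longleftrightarrow>
    (\<forall>a b. {a, b} \<in> E \<longrightarrow>
      (\<forall>\<alpha>. defining_form l {p \<in> affine_space l. p a = p b} \<alpha> \<longrightarrow>
        der_apply \<theta> \<alpha> \<in> principal_ideal l \<alpha>))"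
    using True unfolding log_der_def graphic_arrangement_def by blast
  also have "\<dots> \<longleftrightarrow> (\<forall>a b. {a, b} \<in> E \<longrightarrow>
      (\<forall>m. a \<notin> keys m \<and> b \<notin> keys m \<longrightarrow>
        lookup (subst (shear a 0) (lookup \<theta> a)) m = lookup (subst (shear b 0) (lookup \<theta> b)) m))"
    by (intro all_cong1 imp_cong refl edge_iff)
  finally show ?thesis using True by blast
next
  case False
  then show ?thesis by (simp add: log_der_def)
qed

section \<open>Dimension of the graded pieces\<close>

text \<open>Duality of \<open>e\<close> and \<open>b\<close> makes the vectors \<open>b i\<close>
  distinct and independent. They span because subtracting from \<open>v\<close> its expansion with
  coefficients \<open>e i v\<close> leaves a vector that all functionals annihilate.\<close>

lemma (in vector_space) dim_eq_card_dual_family: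
  assumes V: "subspace V" and I: "finite I"
    and bV: "\<And>i. i \<in> I \<Longrightarrow> b i \<in> V"
    and e_add: "\<And>i x y. e i (x + y) = e i x + e i y"
    and e_scale: "\<And>i c x. e i (scale c x) = c * e i x"
    and dual: "\<And>i j. i \<in> I \<Longrightarrow> j \<in> I \<Longrightarrow> e i (b j) = (if i = j then 1 else 0)"
    and sep: "\<And>v. v \<in> V \<Longrightarrow> (\<And>i. i \<in> I \<Longrightarrow> e i v = 0) \<Longrightarrow> v = 0"
  shows "dim V = card I"
proof (rule dim_unique)
  have e_0: "e i 0 = 0" for i
    using e_scale[of i 0 0] by simp
  have e_sum: "e i (\<Sum>x\<in>A. f x) = (\<Sum>x\<in>A. e i (f x))" for i f and A :: "'d set"
    by (induction A rule: infinite_finite_induct) (simp_all add: e_add e_0)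
  have coeff: "e i (\<Sum>j\<in>I. scale (f j) (b j)) = f i" if "i \<in> I" for i f
    using that I by (simp add: e_sum e_scale dual if_distrib[of "(*) _"] cong: if_cong)
  have inj: "inj_on b I"
    using dual by (intro inj_onI) (metis zero_neq_one)
  show "b ` I \<subseteq> V" using bV by auto
  show "card (b ` I) = card I" using inj by (rule card_image)
  show "independent (b ` I)"
  proof (rule independent_if_scalars_zero)
    fix f x assume 0: "(\<Sum>x\<in>b ` I. scale (f x) x) = 0" and "x \<in> b ` I"
    then obtain i where i: "i \<in> I" "x = b i" by blast
    have "(\<Sum>j\<in>I. scale (f (b j)) (b j)) = 0"
      using 0 inj by (simp add: sum.reindex)
    with coeff[OF i(1), of "\<lambda>j. f (b j)"] i(2) show "f x = 0" by (simp add: e_0)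
  qed (use I in auto)
  show "V \<subseteq> span (b ` I)"
  proof
    fix v assume v: "v \<in> V"
    let ?s = "\<Sum>i\<in>I. scale (e i v) (b i)"
    have "v - ?s = 0"
    proof (rule sep)
      show "v - ?s \<in> V"
        using V v bV by (intro subspace_diff subspace_sum subspace_scale) auto
      show "e i (v - ?s) = 0" if "i \<in> I" for i
        using e_add[of i "v - ?s" ?s] coeff[OF that, of "\<lambda>i. e i v"] by simp
    qed
    then have "v = ?s" by simp
    also have "\<dots> \<in> span (b ` I)"
      by (intro span_sum span_scale span_base) auto
    finally show "v \<in> span (b ` I)" .
  qed
qed

lemma equiv_connected_rel: "equiv V (connected_rel V E)"
proof (rule equivI)
  let ?R = "{(a, b). {a, b} \<in> E}"
  have "sym ?R" by (auto simp: sym_def insert_commute)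
  then have "sym (?R\<^sup>*)" by (rule sym_rtrancl)
  then show "sym (connected_rel V E)"
    by (auto simp: connected_rel_def sym_def)
  show "refl_on V (connected_rel V E)"
    by (auto simp: connected_rel_def refl_on_def)
  show "trans (connected_rel V E)"
    by (auto simp: connected_rel_def trans_def)
  show "connected_rel V E \<subseteq> V \<times> V"
    by (auto simp: connected_rel_def)
qed

section \<open>Counting monomials by support\<close>

text \<open>Index 0 stands for the coordinate \<open>y\<close>. One set of monomials serves the
  coordinates at all vertices; those centred at \<open>u\<close> use the monomials without
  \<open>x_u\<close>.\<close>

definition monoms :: "nat \<Rightarrow> nat \<Rightarrow> (nat \<Rightarrow>\<^sub>0 nat) set" where
  "monoms l d = {m. keys m \<subseteq> {0..l} \<and> total_degree m = d}"

text \<open>The exponent of \<open>y = x_0\<close> is left free, so only the other variables are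
  prescribed.\<close>

definition monoms_supp :: "nat set \<Rightarrow> nat \<Rightarrow> (nat \<Rightarrow>\<^sub>0 nat) set" where
  "monoms_supp A d = {m. keys m - {0} = A \<and> total_degree m = d}"

text \<open>Dividing by \<open>x_v\<close> either removes \<open>v\<close> from the support or keeps
  it. This is the bijection behind Pascal's rule.\<close>

lemma monoms_supp_insert_Suc:
  assumes "v \<notin> A" "v \<noteq> 0"
  shows "monoms_supp (insert v A) (Suc d) =
    (\<lambda>m. m + single v 1) ` (monoms_supp A d \<union> monoms_supp (insert v A) d)"
proof (intro equalityI subsetI)
  fix m assume m: "m \<in> monoms_supp (insert v A) (Suc d)"
  then have v: "v \<in> keys m" by (auto simp: monoms_supp_def)
  have "m = (m - single v 1) + single v 1"
    using v by (intro poly_mapping_eqI)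
      (auto simp: lookup_add lookup_minus lookup_single when_def in_keys_iff)
  then obtain n where mn: "m = n + single v 1" by blast
  have "n \<in> monoms_supp A d \<union> monoms_supp (insert v A) d"
  proof -
    have deg: "total_degree n = d"
      using m by (simp add: monoms_supp_def mn total_degree_add)
    have K: "insert v (keys n) - {0} = insert v A"
      using m by (simp add: monoms_supp_def mn keys_plus_nat)
    show ?thesis
    proof (cases "v \<in> keys n")
      case True
      with K have "keys n - {0} = insert v A" by (simp add: insert_absorb)
      with deg show ?thesis by (simp add: monoms_supp_def)
    next
      case False
      have "insert v (keys n - {0}) = insert v A"
        using K assms(2) by (simp add: insert_Diff_if)
      then have "keys n - {0} = A"
        using False assms(1) by (simp add: insert_ident)
      with deg show ?thesis by (simp add: monoms_supp_def)
    qed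
  qed
  then show "m \<in> (\<lambda>m. m + single v 1) ` (monoms_supp A d \<union> monoms_supp (insert v A) d)"
    unfolding mn by (rule imageI)
next
  fix m assume "m \<in> (\<lambda>m. m + single v 1) ` (monoms_supp A d \<union> monoms_supp (insert v A) d)"
  then obtain n where n: "n \<in> monoms_supp A d \<union> monoms_supp (insert v A) d"
    and m: "m = n + single v 1"
    by (rule imageE)
  from n have deg: "total_degree n = d" and K: "insert v (keys n - {0}) = insert v A"
    by (auto simp only: monoms_supp_def insert_absorb2)
  have "keys m - {0} = insert v (keys n - {0})"
    using assms(2) by (simp add: m keys_plus_nat insert_Diff_if)
  with deg K show "m \<in> monoms_supp (insert v A) (Suc d)"
    by (simp add: monoms_supp_def m total_degree_add)
qed

text \<open>Induction on \<open>A\<close>, then on the degree, with Pascal's rule as the recursion.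
  For empty \<open>A\<close> the only monomial is the power \<open>x_0^d\<close>.\<close>

lemma finite_card_monoms_supp:
  assumes "finite A" "0 \<notin> A"
  shows "finite (monoms_supp A d) \<and> card (monoms_supp A d) = d choose card A"
  using assms
proof (induction A arbitrary: d)
  case empty
  have "monoms_supp {} d = {single 0 d}"
  proof (intro equalityI subsetI)
    fix m assume m: "m \<in> monoms_supp {} d"
    then have "keys m \<subseteq> {0}" by (auto simp: monoms_supp_def)
    then have "total_degree m = lookup m 0" and k: "\<And>i. i \<noteq> 0 \<Longrightarrow> lookup m i = 0"
      by (auto simp: total_degree_superset[of "{0}"] in_keys_iff)
    with m show "m \<in> {single 0 d}"
      by (auto intro!: poly_mapping_eqI simp: monoms_supp_def lookup_single when_def)
  qed (auto simp: monoms_supp_def)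
  then show ?case by simp
next
  case (insert v A)
  have v: "v \<noteq> 0" and A0: "0 \<notin> A" using insert.prems by auto
  have card_insert: "card (insert v A) = Suc (card A)"
    by (rule card_insert_disjoint[OF insert.hyps])
  show ?case
  proof (induction d)
    case 0
    have "m \<notin> monoms_supp (insert v A) 0" for m
    proof
      assume m: "m \<in> monoms_supp (insert v A) 0"
      then have "v \<in> keys m" by (auto simp: monoms_supp_def)
      with m show False by (simp add: monoms_supp_def total_degree_def in_keys_iff)
    qed
    then have "monoms_supp (insert v A) 0 = {}" by blast
    then show ?case by (simp add: card_insert)
  next
    case (Suc d)
    let ?M = "monoms_supp A d \<union> monoms_supp (insert v A) d"
    have eq: "monoms_supp (insert v A) (Suc d) = (\<lambda>m. m + single v 1) ` ?M"
      by (rule monoms_supp_insert_Suc[OF insert.hyps(2) v])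
    have "card ((\<lambda>m. m + single v 1) ` ?M) = card ?M"
      by (rule card_image) (simp add: inj_on_def)
    also have "\<dots> = card (monoms_supp A d) + card (monoms_supp (insert v A) d)"
      using insert.IH[OF A0, of d] Suc insert.hyps(2)
      by (intro card_Un_disjoint) (auto simp: monoms_supp_def)
    also have "\<dots> = Suc d choose card (insert v A)"
      using insert.IH[OF A0, of d] Suc by (simp only: card_insert binomial_Suc_Suc)
    finally show ?case
      using insert.IH[OF A0, of d] Suc unfolding eq by blast
  qed
qed

lemma monoms_eq: "monoms l d = (\<Union>A\<in>Pow {1..l}. monoms_supp A d)"
proof -
  have "{0..l} = insert 0 {1..l}" by auto
  then show ?thesis by (auto simp: monoms_def monoms_supp_def)
qed

lemma finite_monoms: "finite (monoms l d)"
  unfolding monoms_eq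
proof (intro finite_UN_I)
  fix A assume "A \<in> Pow {1..l}"
  then have "finite A" "0 \<notin> A" by (auto intro: finite_subset)
  then show "finite (monoms_supp A d)" by (simp add: finite_card_monoms_supp)
qed simp

section \<open>A basis of the graded pieces\<close>

text \<open>A basis is indexed by pairs of a monomial \<open>m\<close> and a component
  \<open>C\<close> of the subgraph induced on the vertices outside \<open>keys m\<close>. The count
  of such pairs is the sum on the right.\<close>

lemma dim_graded_log_der:
  assumes G: "simple_graph {1..l} E"
  shows "vector_space.dim der_scale
      (graded_part (log_der l (graphic_arrangement l E :: (nat \<Rightarrow> 'k::field) set set)) d) =
    (\<Sum>m\<in>monoms l d. num_components ({1..l} - keys m) (induced_edges E ({1..l} - keys m)))"
proof -
  interpret D: vector_space "der_scale :: 'k \<Rightarrow> 'k der \<Rightarrow> 'k der"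
    by (rule vector_space_der_scale)
  let ?V = "graded_part (log_der l (graphic_arrangement l E :: (nat \<Rightarrow> 'k) set set)) d"
  define W where "W m = {1..l} - keys m" for m :: "nat \<Rightarrow>\<^sub>0 nat"
  define R where "R m = connected_rel (W m) (induced_edges E (W m))" for m
  define I where "I = (SIGMA m:monoms l d. W m // R m)"
  define F where "F \<theta> u = subst (shear u 0) (lookup \<theta> u)" for \<theta> :: "'k der" and u
  \<comment> \<open>At each vertex \<open>u\<close> of \<open>C\<close> the entry is
    \<open>m\<close>, transported back from the coordinates centred at \<open>u\<close>; all other
    entries are 0.\<close>
  define b where "b = (\<lambda>(m, C). \<Sum>u\<in>C. single u (subst (shear 0 u) (single m (1 :: 'k))))"
  \<comment> \<open>The coefficient of \<open>m\<close> at one chosen vertex of \<open>C\<close>. On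
    \<open>?V\<close> the choice is immaterial, and fixing it makes \<open>e\<close> linear on all
    derivations.\<close>
  define e where "e = (\<lambda>(m, C) \<theta>. lookup (F \<theta> (SOME u. u \<in> C)) m)"

  have V_iff: "\<theta> \<in> ?V \<longleftrightarrow> keys \<theta> \<subseteq> {1..l} \<and>
      (\<forall>u. lookup \<theta> u \<in> polys_in {1..l}) \<and> (\<forall>u. homogeneous d (lookup \<theta> u)) \<and>
      (\<forall>u v m. {u, v} \<in> E \<and> u \<notin> keys m \<and> v \<notin> keys m \<longrightarrow> lookup (F \<theta> u) m = lookup (F \<theta> v) m)"
    for \<theta> :: "'k der"
    unfolding graded_part_def by (auto simp: log_der_graphic_iff[OF G] Der_def poly_ring_eq F_def)
  have eq_R: "equiv (W m) (R m)" for m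
    unfolding R_def by (rule equiv_connected_rel)
  have R_path: "(u, v) \<in> {(a, b). {a, b} \<in> induced_edges E (W m)}\<^sup>*"
    if "(u, v) \<in> R m" for u v m
    using that by (simp add: R_def connected_rel_def)
  have edge: "u \<in> {1..l}" "v \<in> {1..l}" if "{u, v} \<in> E" for u v
    using G that unfolding simple_graph_def by fastforce+
  have some_in: "(SOME u. u \<in> C) \<in> C" if "C \<in> W m // R m" for m C
    using in_quotient_imp_non_empty[OF eq_R that] by (simp add: some_in_eq)
  have C_sub: "C \<subseteq> W m" if "C \<in> W m // R m" for m C
    using in_quotient_imp_subset[OF eq_R that] .
  have fin_C: "finite C" if "C \<in> W m // R m" for m C
    using C_sub[OF that] by (rule finite_subset) (simp add: W_def)
  have lookup_b: "lookup (b (m, C)) u = (if u \<in> C then subst (shear 0 u) (single m 1) else 0)"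
    if "C \<in> W m // R m" for m C u
    using fin_C[OF that] by (simp add: b_def lookup_sum lookup_single when_def)
  have F_b: "F (b (m, C)) u = (if u \<in> C then single m 1 else 0)"
    if "C \<in> W m // R m" for m C u
  proof -
    have "u \<notin> keys m" if "u \<in> C"
      using C_sub[OF \<open>C \<in> W m // R m\<close>] that by (auto simp: W_def)
    then show ?thesis
      by (auto simp: F_def lookup_b[OF that] intro!: shear_shear polys_in_single)
  qed
  have F_add: "F (x + y) u = F x u + F y u" for x y u
    by (simp add: F_def lookup_add subst_add)
  have F_scale: "F (der_scale c x) u = Const c * F x u" for c x u
    by (simp add: F_def lookup_der_scale subst_mult)

  have "D.dim ?V = card I"
  proof (rule D.dim_eq_card_dual_family[where b = b and e = e])
    show "D.subspace ?V"
    proof (rule D.subspaceI)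
      show "0 \<in> ?V" by (simp add: V_iff F_def)
      show "x + y \<in> ?V" if "x \<in> ?V" "y \<in> ?V" for x y
        using that keys_add[of x y] unfolding V_iff
        by (auto simp: lookup_add polys_in_add homogeneous_add F_add)
      show "der_scale c x \<in> ?V" if "x \<in> ?V" for c x
      proof -
        have "keys (der_scale c x) \<subseteq> keys x"
          by (auto simp: in_keys_iff lookup_der_scale)
        with that show ?thesis unfolding V_iff
          by (auto simp: lookup_der_scale polys_in_mult homogeneous_Const_mult F_scale)
      qed
    qed
    show "finite I"
      unfolding I_def
      by (intro finite_SigmaI finite_monoms finite_quotient)
        (auto simp: W_def R_def connected_rel_def)
    show "e i (x + y) = e i x + e i y" for i x y
      by (simp add: e_def F_add lookup_add split: prod.split)
    show "e i (der_scale c x) = c * e i x" for i c x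
      by (simp add: e_def F_scale split: prod.split)
    show "e i (b j) = (if i = j then 1 else 0)" if ij: "i \<in> I" "j \<in> I" for i j
    proof -
      obtain m C where i: "i = (m, C)" "m \<in> monoms l d" "C \<in> W m // R m"
        using ij(1) unfolding I_def by blast
      obtain m' C' where j: "j = (m', C')" "m' \<in> monoms l d" "C' \<in> W m' // R m'"
        using ij(2) unfolding I_def by blast
      let ?u = "SOME u. u \<in> C"
      have u: "?u \<in> C" using some_in[OF i(3)] .
      \<comment> \<open>Two components of the same induced subgraph that share a vertex are
        equal.\<close>
      have "C = C'" if "m = m'" "?u \<in> C'"
        using quotient_disj[OF eq_R i(3)] j(3) that u by blast
      then have "i = j \<longleftrightarrow> m = m' \<and> ?u \<in> C'" using u i(1) j(1) by auto
      then show ?thesis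
        unfolding e_def i(1) j(1) by (auto simp: F_b[OF j(3)] lookup_single when_def)
    qed
    show "b i \<in> ?V" if iI: "i \<in> I" for i
    proof -
      obtain m C where i: "i = (m, C)" "m \<in> monoms l d" "C \<in> W m // R m"
        using iI unfolding I_def by blast
      have C1: "C \<subseteq> {1..l}" using C_sub[OF i(3)] by (auto simp: W_def)
      have "keys (b i) \<subseteq> C" by (auto simp: i(1) in_keys_iff lookup_b[OF i(3)] split: if_splits)
      moreover have "lookup (b i) u \<in> polys_in {1..l}" for u
      proof (cases "u \<in> C")
        case True
        with C1 have u: "u \<in> {1..l}" by blast
        have "subst (shear 0 u) (single m (1 :: 'k)) \<in> polys_in (insert u {0..l} - {0})"
          using i(2) u by (intro polys_in_shear polys_in_single) (auto simp: monoms_def)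
        moreover have "insert u {0..l} - {0} = {1..l}" using u by auto
        ultimately show ?thesis using True by (simp add: i(1) lookup_b[OF i(3)])
      qed (simp add: i(1) lookup_b[OF i(3)])
      moreover have "homogeneous d (lookup (b i) u)" for u
        using i(2) by (simp add: i(1) lookup_b[OF i(3)] homogeneous_subst homogeneous_single
          homogeneous_shear monoms_def del: One_nat_def)
      moreover have "lookup (F (b i) u) m' = lookup (F (b i) v) m'"
        if uv: "{u, v} \<in> E" "u \<notin> keys m'" "v \<notin> keys m'" for u v m'
      proof (cases "m' = m")
        case True
        \<comment> \<open>An edge whose ends both avoid \<open>keys m\<close> lies in the induced
          subgraph, so \<open>C\<close> contains both ends or neither.\<close>
        then have "u \<in> W m" "v \<in> W m" using uv edge[OF uv(1)] by (auto simp: W_def)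
        with uv(1) have "(u, v) \<in> R m"
          by (auto simp: R_def connected_rel_def induced_edges_def)
        then have "u \<in> C \<longleftrightarrow> v \<in> C"
          using in_quotient_imp_closed[OF eq_R i(3)] eq_R
          by (meson equivE symD)
        then show ?thesis by (simp add: i(1) F_b[OF i(3)])
      qed (simp add: i(1) F_b[OF i(3)] lookup_single when_def)
      ultimately show ?thesis using C1 unfolding V_iff by blast
    qed
    show "\<theta> = 0" if \<theta>: "\<theta> \<in> ?V" and zero: "\<And>i. i \<in> I \<Longrightarrow> e i \<theta> = 0" for \<theta>
    proof (rule poly_mapping_eqI)
      fix u
      show "lookup \<theta> u = lookup 0 u"
      proof (cases "u \<in> {1..l}")
        case True
        have pol: "lookup \<theta> u \<in> polys_in {1..l}" using \<theta> by (simp add: V_iff)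
        have F_in: "F \<theta> u \<in> polys_in (insert 0 {1..l} - {u})"
          unfolding F_def using pol True by (intro polys_in_shear) auto
        have F_hom: "homogeneous d (F \<theta> u)"
          using \<theta> unfolding F_def V_iff by (intro homogeneous_subst homogeneous_shear) auto
        \<comment> \<open>A nonzero coefficient at \<open>m\<close> puts \<open>u\<close> into
          \<open>W m\<close>, because the coordinates at \<open>u\<close> omit \<open>x_u\<close>.
          It is then carried to the chosen vertex of the component of \<open>u\<close>, where it
          must vanish.\<close>
        have "lookup (F \<theta> u) m = 0" for m
        proof (rule ccontr)
          assume "lookup (F \<theta> u) m \<noteq> 0"
          then have m: "m \<in> keys (F \<theta> u)" by (simp add: in_keys_iff)
          have km: "keys m \<subseteq> insert 0 {1..l} - {u}"
            using F_in m unfolding polys_in_def by blast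
          then have um: "u \<in> W m" using True by (auto simp: W_def)
          have "keys m \<subseteq> {0..l}" using km by auto
          then have mm: "m \<in> monoms l d"
            using F_hom m by (simp add: homogeneous_def monoms_def)
          let ?C = "R m `` {u}"
          have C: "?C \<in> W m // R m" using um by (rule quotientI)
          have "(u, SOME v. v \<in> ?C) \<in> R m"
            using some_in[OF C] by simp
          \<comment> \<open>Every edge of the path has both ends in \<open>W m\<close>, so the edge
            condition preserves the coefficient of \<open>m\<close> at each step.\<close>
          then have "(u, SOME v. v \<in> ?C) \<in> {(a, b). {a, b} \<in> induced_edges E (W m)}\<^sup>*"
            by (rule R_path)
          then have "lookup (F \<theta> u) m = lookup (F \<theta> (SOME v. v \<in> ?C)) m"
          proof induction
            case (step y z)
            then have "{y, z} \<in> E" "y \<notin> keys m" "z \<notin> keys m"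
              by (auto simp: induced_edges_def W_def)
            then have "lookup (F \<theta> y) m = lookup (F \<theta> z) m"
              using \<theta> by (simp add: V_iff)
            with step.IH show ?case by simp
          qed simp
          also have "\<dots> = 0"
            using zero[of "(m, ?C)"] C mm by (simp add: I_def e_def)
          finally show False using \<open>lookup (F \<theta> u) m \<noteq> 0\<close> by simp
        qed
        \<comment> \<open>The change of coordinates is invertible on \<open>S\<close>, so the entry
          of \<theta> at \<open>u\<close> vanishes too.\<close>
        then have "F \<theta> u = 0" by (intro poly_mapping_eqI) simp
        then have "subst (shear 0 u) (F \<theta> u) = 0" by simp
        moreover have "lookup \<theta> u \<in> polys_in (- {0})"
          using pol by (fastforce simp: polys_in_def)
        ultimately show ?thesis by (simp add: F_def shear_shear)
      next
        case False
        then show ?thesis using \<theta> by (auto simp: V_iff in_keys_iff)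
      qed
    qed
  qed
  also have "card I = (\<Sum>m\<in>monoms l d. card (W m // R m))"
    unfolding I_def
    by (intro card_SigmaI finite_monoms ballI finite_quotient)
      (auto simp: W_def R_def connected_rel_def)
  finally show ?thesis by (simp add: num_components_def W_def R_def)
qed

section \<open>From monomials to the Hilbert series\<close>

text \<open>Group the monomials by their support \<open>A\<close> apart from 0, pass to the
  complement \<open>W\<close>, and group again by the cardinality of \<open>W\<close>.\<close>

lemma sum_monoms_eq_f_num:
  "(\<Sum>m\<in>monoms l d. num_components ({1..l} - keys m) (induced_edges E ({1..l} - keys m))) =
    (\<Sum>i<l. f_num l E i * (d choose i))"
proof -
  let ?c = "\<lambda>W. num_components W (induced_edges E W)"
  let ?P = "Pow {1..l}"
  \<comment> \<open>The empty set belongs to the index \<open>i = l\<close>, which lies outside the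
    range of summation; its contribution is 0.\<close>
  have zero: "?c {} = 0" by (simp add: num_components_def)
  have "(\<Sum>m\<in>monoms l d. ?c ({1..l} - keys m)) =
      (\<Sum>A\<in>?P. \<Sum>m | m \<in> monoms l d \<and> keys m - {0} = A. ?c ({1..l} - keys m))"
    by (rule sum.group[symmetric, OF finite_monoms]) (auto simp: monoms_eq monoms_supp_def)
  also have "\<dots> = (\<Sum>A\<in>?P. (d choose card A) * ?c ({1..l} - A))"
  proof (rule sum.cong[OF refl])
    fix A assume A: "A \<in> ?P"
    then have fin: "finite A" and "0 \<notin> A" by (auto intro: finite_subset)
    have "{m. m \<in> monoms l d \<and> keys m - {0} = A} = monoms_supp A d"
      using A by (auto simp: monoms_eq monoms_supp_def)
    moreover have "{1..l} - keys m = {1..l} - A" if "m \<in> monoms_supp A d" for m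
      using that by (auto simp: monoms_supp_def)
    ultimately show "(\<Sum>m | m \<in> monoms l d \<and> keys m - {0} = A. ?c ({1..l} - keys m)) =
        (d choose card A) * ?c ({1..l} - A)"
      using finite_card_monoms_supp[OF fin \<open>0 \<notin> A\<close>] by simp
  qed
  also have "\<dots> = (\<Sum>W\<in>?P. (d choose (l - card W)) * ?c W)"
  proof (rule sum.reindex_bij_witness[of _ "\<lambda>W. {1..l} - W" "\<lambda>A. {1..l} - A"])
    fix A assume "A \<in> ?P"
    then have "A \<subseteq> {1..l}" by simp
    then have "card ({1..l} - A) = l - card A" "card A \<le> l"
      using card_mono[of "{1..l}" A] by (simp_all add: card_Diff_subset finite_subset)
    then show "(d choose (l - card ({1..l} - A))) * ?c ({1..l} - A) =
        (d choose card A) * ?c ({1..l} - A)" by simp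
  qed auto
  also have "\<dots> = (\<Sum>W\<in>?P - {{}}. (d choose (l - card W)) * ?c W)"
    by (rule sum.mono_neutral_right) (use zero in auto)
  also have "\<dots> = (\<Sum>i<l. \<Sum>W | W \<in> ?P - {{}} \<and> l - card W = i. (d choose (l - card W)) * ?c W)"
  proof (rule sum.group[symmetric])
    show "(\<lambda>W. l - card W) ` (?P - {{}}) \<subseteq> {..<l}"
    proof (rule image_subsetI)
      fix W assume "W \<in> ?P - {{}}"
      then have W: "W \<in> ?P" "W \<noteq> {}" by auto
      then have "0 < card W" using finite_subset[of W "{1..l}"] by (simp add: card_gt_0_iff)
      moreover have "0 < l" using W by (cases l) auto
      ultimately show "l - card W \<in> {..<l}" by simp
    qed
  qed simp_all
  also have "\<dots> = (\<Sum>i<l. f_num l E i * (d choose i))"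
  proof (rule sum.cong[OF refl])
    fix i assume i: "i \<in> {..<l}"
    \<comment> \<open>Since \<open>i < l\<close>, the cardinality \<open>l - i\<close> is positive
      and excludes the empty set.\<close>
    have "l - card W = i \<and> W \<noteq> {} \<longleftrightarrow> card W = l - i" if "W \<subseteq> {1..l}" for W
      using i that card_mono[of "{1..l}" W] by (auto simp: finite_subset)
    then have "{W. W \<in> ?P - {{}} \<and> l - card W = i} = {W. W \<subseteq> {1..l} \<and> card W = l - i}"
      by auto
    moreover have "(\<Sum>W | W \<in> ?P - {{}} \<and> l - card W = i. (d choose (l - card W)) * ?c W)
        = (\<Sum>W | W \<in> ?P - {{}} \<and> l - card W = i. ?c W * (d choose i))"
      by (rule sum.cong) (auto simp: mult.commute)
    ultimately show "(\<Sum>W | W \<in> ?P - {{}} \<and> l - card W = i. (d choose (l - card W)) * ?c W)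
        = f_num l E i * (d choose i)"
      by (simp add: f_num_def sum_distrib_right)
  qed
  finally show ?thesis .
qed

text \<open>By Pascal's rule, multiplying the series of \<open>d choose Suc i\<close> by
  \<open>1 - t\<close> gives \<open>t\<close> times the series of \<open>d choose i\<close>. The
  induction starts with the geometric series.\<close>

lemma fps_X_power_divide:
  "fps_X ^ i / (1 - fps_X) ^ (i + 1) = Abs_fps (\<lambda>d. of_nat (d choose i) :: 'a::field)"
proof -
  let ?B = "\<lambda>i. Abs_fps (\<lambda>d. of_nat (d choose i) :: 'a)"
  have "?B i * (1 - fps_X) ^ (i + 1) = fps_X ^ i"
  proof (induction i)
    case 0
    show ?case
      by (rule fps_ext) (auto simp: algebra_simps fps_mult_fps_X_plus_1_nth)
  next
    case (Suc i)
    have "?B (Suc i) * (1 - fps_X) = fps_X * ?B i"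
    proof (rule fps_ext)
      fix d
      show "fps_nth (?B (Suc i) * (1 - fps_X)) d = fps_nth (fps_X * ?B i) d"
        by (cases d) (simp_all add: right_diff_distrib)
    qed
    then have "?B (Suc i) * (1 - fps_X) ^ (Suc i + 1) = fps_X * (?B i * (1 - fps_X) ^ (i + 1))"
      by (simp add: mult_ac)
    with Suc show ?case by simp
  qed
  \<comment> \<open>The constant term is 1, so the denominator is nonzero and can be
    cancelled.\<close>
  moreover have "fps_nth ((1 - fps_X :: 'a fps) ^ (i + 1)) 0 \<noteq> 0"
    by (simp add: fps_nth_power_0)
  ultimately show ?thesis
    by (metis fps_nonzeroI nonzero_mult_div_cancel_right)
qed

theorem corollary7p14:
  fixes l :: nat and E :: "nat set set"
  assumes "simple_graph {1..l} E"
  shows "Hilb (log_der l (graphic_arrangement l E :: (nat \<Rightarrow> 'k::field) set set)) =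
    (\<Sum>i<l. of_nat (f_num l E i) * (fps_X ^ i / (1 - fps_X) ^ (i + 1)))"
proof (rule fps_ext)
  fix d
  have "fps_nth (Hilb (log_der l (graphic_arrangement l E :: (nat \<Rightarrow> 'k) set set))) d =
      of_nat (\<Sum>i<l. f_num l E i * (d choose i))"
    unfolding Hilb_def fps_nth_Abs_fps dim_graded_log_der[OF assms] sum_monoms_eq_f_num ..
  also have "\<dots> = fps_nth (\<Sum>i<l. of_nat (f_num l E i) * (fps_X ^ i / (1 - fps_X) ^ (i + 1))) d"
    unfolding fps_X_power_divide
    by (simp add: fps_sum_nth flip: fps_of_nat)
  finally show "fps_nth (Hilb (log_der l (graphic_arrangement l E :: (nat \<Rightarrow> 'k) set set))) d =
      fps_nth (\<Sum>i<l. of_nat (f_num l E i) * (fps_X ^ i / (1 - fps_X) ^ (i + 1))) d" .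
qed

end
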